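(* Let $D$ be any cycle digraph. Then $P_D$ is terminal Fano if and only if $D$ is not, up to a relabeling of the vertices (i.e. up to isomorphism of digraphs), one of the following six cycle digraphs: $$C_3^{\{1\}},\quad C_3^{\{1,2\}},\quad C_3^{\{1,2,3\}},\quad C_4^{\{1,3\}},\quad C_4^{\{1,2,3\}},\quad C_4^{\{1,2,3,4\}}.$$
   Context: For $n\ge 3$ and $S\subseteq[n]=\{1,\ldots,n\}$, $C_n^S$ denotes the simple digraph on the vertex set $[n]$ whose set of directed edges $(\text{tail},\text{head})$ is $\overrightarrow{E}\cup\overleftarrow{E}$, where $$\overrightarrow{E}=\{(1,2),(2,3),\ldots,(n-1,n),(n,1)\},\qquad \overleftarrow{E}=\{(i,i-1): i\in S\},$$ with the convention that $(1,0)$ means $(1,n)$. A cycle digraph is a digraph that, up to a relabeling of the vertices, equals $C_n^S$ for some $n\ge3$ and $S\subseteq[n]$. For a digraph $D$ on $[n]$ let $a_{i,j}$ be the number of directed edges from $i$ (tail) to $j$ (head), and $\mathrm{outdeg}(i)=\sum_j a_{i,j}$. The Laplacian matrix of $D$ is $L(D)=O(D)-A(D)$, where $A(D)=(a_{i,j})$ and $O(D)$ is the diagonal matrix with entries $\mathrm{outdeg}(i)$. The Laplacian polytope of $D$ is $P_D=\operatorname{conv}\{\mathbf{v}_1,\ldots,\mathbf{v}_n\}\subset\mathbb{R}^n$, where $\mathbf{v}_i$ is the $i$-th row of $L(D)$; for a cycle digraph it is an $(n-1)$-dimensional simplex with the origin in its relative interior. Such a simplex is called terminal Fano if it contains no lattice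 points (points of $\mathbb{Z}^n$) other than the origin and its vertices. *)

theory Defs
  imports "HOL-Analysis.Analysis" "Graph_Theory.Digraph_Isomorphism" "Graph_Theory.Pair_Digraph"
begin

definition cycle_pair_digraph :: "nat \<Rightarrow> nat set \<Rightarrow> nat pair_pre_digraph" where
  "cycle_pair_digraph n S =
     \<lparr> pverts = {1..n},
       parcs = {(i, i + 1) | i. i \<in> {1..<n}} \<union> {(n, 1)}
             \<union> {(i, if i = 1 then n else i - 1) | i. i \<in> S} \<rparr>"

abbreviation cycle_graph :: "nat \<Rightarrow> nat set \<Rightarrow> (nat, nat \<times> nat) pre_digraph" where
  "cycle_graph n S \<equiv> with_proj (cycle_pair_digraph n S)"

definition cycle_digraph :: "('a, 'e) pre_digraph \<Rightarrow> bool" where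
  "cycle_digraph D \<longleftrightarrow> (\<exists>n S. n \<ge> 3 \<and> S \<subseteq> {1..n} \<and> digraph_iso (cycle_graph n S) D)"

text \<open>A digraph on n vertices has its vertex set labelled by a finite type of cardinality n,
  so that its matrices and its polytope live over that index type. The definitions below are
  meant for digraphs whose vertex set is the whole type.\<close>

definition adj_mat :: "('n::finite, 'e) pre_digraph \<Rightarrow> real ^ 'n ^ 'n" where
  "adj_mat D = (\<chi> i j. real (card {e \<in> arcs D. tail D e = i \<and> head D e = j}))"

definition outdeg_mat :: "('n::finite, 'e) pre_digraph \<Rightarrow> real ^ 'n ^ 'n" where
  "outdeg_mat D = (\<chi> i j. if i = j then (\<Sum>k\<in>UNIV. adj_mat D $ i $ k) else 0)"

definition laplacian :: "('n::finite, 'e) pre_digraph \<Rightarrow> real ^ 'n ^ 'n" where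
  "laplacian D = outdeg_mat D - adj_mat D"

definition laplacian_polytope :: "('n::finite, 'e) pre_digraph \<Rightarrow> (real ^ 'n) set" where
  "laplacian_polytope D = convex hull (rows (laplacian D))"

text \<open>A terminal Fano simplex here has codimension one in the ambient space and contains the
  origin in its relative interior; these properties are part of the predicate.\<close>

definition terminal_fano :: "(real ^ 'n::finite) set \<Rightarrow> bool" where
  "terminal_fano P \<longleftrightarrow>
     (int CARD('n) - 1) simplex P \<and> 0 \<in> rel_interior P \<and>
     (\<forall>x\<in>P. (\<forall>i. x $ i \<in> \<int>) \<longrightarrow> x = 0 \<or> x extreme_point_of P)"

end

theory Submission
  imports Defs
begin

text \<open>Write a point of the polytope as \<open>x = (\<Sum>i. c\<^sub>i v\<^sub>i)\<close> with convex coefficients \<open>c\<close>. Then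
  \<open>x\<^sub>j = f\<^sub>j - f\<^sub>j\<^sub>-\<^sub>1\<close>, where \<open>f\<^sub>j = c\<^sub>j - [j+1 \<in> S] c\<^sub>j\<^sub>+\<^sub>1\<close> lies in \<open>[-1, 1]\<close>. If \<open>x\<close> is a lattice point,
  all \<open>f\<^sub>j\<close> agree modulo 1, so unless \<open>x\<close> is a vertex or the origin, they take exactly the two values
  \<open>\<theta>\<close> and \<open>\<theta> - 1\<close> for some \<open>\<theta>\<close> strictly between 0 and 1. The value \<open>\<theta>\<close> at \<open>j\<close> forces
  \<open>c\<^sub>j \<ge> \<theta>\<close>, and \<open>\<theta> - 1\<close> forces \<open>j+1 \<in> S\<close> and \<open>c\<^sub>j\<^sub>+\<^sub>1 \<ge> 1 - \<theta>\<close>. Since the coefficients sum to 1,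
  going round the cycle leaves only \<open>n = 3\<close> with \<open>S\<close> nonempty, and \<open>n = 4\<close> with two opposite vertices
  in \<open>S\<close>; in these cases an edge of the simplex contains a further lattice point.\<close>

section \<open>Affine independence and convex hulls of finite families\<close>

text \<open>For families, equal members \<open>v i = v k\<close> already give a nontrivial relation
  with coefficients 1 and -1, so injectivity comes along.\<close>

lemma affine_independent_range:
  fixes v :: "'i::finite \<Rightarrow> 'a::real_vector"
  assumes "\<And>c. sum c UNIV = 0 \<Longrightarrow> (\<Sum>i\<in>UNIV. c i *\<^sub>R v i) = 0 \<Longrightarrow> c = (\<lambda>_. 0)"
  shows "inj v" and "\<not> affine_dependent (range v)"
proof -
  show inj: "inj v"
  proof (rule injI, rule ccontr)
    fix i k assume eq: "v i = v k" and "i \<noteq> k"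
    let ?c = "\<lambda>j. (if j = i then 1 else 0) - (if j = k then 1 else 0) :: real"
    have "?c = (\<lambda>_. 0)"
      by (rule assms) (simp_all add: sum_subtractf scaleR_diff_left if_distrib[of "\<lambda>r. r *\<^sub>R _"] eq cong: if_cong)
    from fun_cong[OF this, of i] show False using \<open>i \<noteq> k\<close> by simp
  qed
  show "\<not> affine_dependent (range v)"
  proof
    assume "affine_dependent (range v)"
    then obtain U where U: "sum U (range v) = 0" "\<exists>x\<in>range v. U x \<noteq> 0"
        "(\<Sum>x\<in>range v. U x *\<^sub>R x) = 0"
      by (auto simp: affine_dependent_explicit_finite)
    have "U \<circ> v = (\<lambda>_. 0)"
      using U(1,3) by (intro assms) (simp_all add: sum.reindex[OF inj] o_def)
    then show False using U(2) by (auto simp: fun_eq_iff)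
  qed
qed

lemma rel_interior_convex_hull_range:
  fixes v :: "'i::finite \<Rightarrow> 'a::euclidean_space"
  assumes "inj v" and "\<not> affine_dependent (range v)"
    and "\<And>i. 0 < c i" and "sum c UNIV = 1"
  shows "(\<Sum>i\<in>UNIV. c i *\<^sub>R v i) \<in> rel_interior (convex hull (range v))"
  unfolding rel_interior_convex_hull_explicit[OF assms(2)] mem_Collect_eq
  by (rule exI[of _ "\<lambda>x. c (inv v x)"]) (use assms in \<open>auto simp: sum.reindex\<close>)

lemma convex_hull_range_finite:
  fixes v :: "'i::finite \<Rightarrow> 'a::real_vector"
  assumes "inj v" and "x \<in> convex hull (range v)"
  shows "\<exists>c. (\<forall>i. 0 \<le> c i) \<and> sum c UNIV = 1 \<and> x = (\<Sum>i\<in>UNIV. c i *\<^sub>R v i)"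
proof -
  obtain u where u: "\<forall>y\<in>range v. 0 \<le> u y" "sum u (range v) = 1"
      "(\<Sum>y\<in>range v. u y *\<^sub>R y) = x"
    using assms(2) by (auto simp: convex_hull_finite)
  show ?thesis
    by (rule exI[of _ "\<lambda>i. u (v i)"]) (use u assms(1) in \<open>auto simp: sum.reindex\<close>)
qed

section \<open>Laplacian rows on an abstract directed cycle\<close>

text \<open>\<open>closed_imp_UNIV\<close> says that \<open>s\<close> has a single orbit and serves
  as induction round the cycle.\<close>

locale cyclic_rows =
  fixes s p :: "'n::finite \<Rightarrow> 'n" and S :: "'n set"
  assumes s_p [simp]: "s (p i) = i" and p_s [simp]: "p (s i) = i"
    and closed_imp_UNIV: "A \<noteq> {} \<Longrightarrow> (\<And>i. i \<in> A \<Longrightarrow> s i \<in> A) \<Longrightarrow> A = UNIV"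
    and card_ge_3: "CARD('n) \<ge> 3"
begin

text \<open>The Laplacian row of vertex \<open>i\<close>: each arc from \<open>i\<close> to
  \<open>j\<close> contributes \<open>axis i 1 - axis j 1\<close>.\<close>

definition v :: "'n \<Rightarrow> real ^ 'n" where
  "v i = axis i 1 - axis (s i) 1 + (if i \<in> S then axis i 1 - axis (p i) 1 else 0)"

text \<open>If vertex \<open>i\<close> sends the amount \<open>c i\<close> along each of its arcs, then \<open>flow c j\<close> is the net amount
  passing from \<open>j\<close> to \<open>s j\<close>, and the combination of the rows with coefficients \<open>c\<close> is its
  divergence.\<close>

definition flow :: "('n \<Rightarrow> real) \<Rightarrow> 'n \<Rightarrow> real" where
  "flow c j = c j - (if s j \<in> S then c (s j) else 0)"

lemma s_eq_iff [simp]: "s i = s j \<longleftrightarrow> i = j"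
  by (metis p_s)

lemma closed_imp_all:
  assumes "P a" and "\<And>i. P i \<Longrightarrow> P (s i)"
  shows "P i"
  using closed_imp_UNIV[of "Collect P"] assms by auto

lemma s_neq [simp]: "s i \<noteq> i" "i \<noteq> s i"
proof -
  show "s i \<noteq> i"
  proof
    assume "s i = i"
    then have "{i} = UNIV" by (intro closed_imp_UNIV) auto
    then have "CARD('n) = card {i}" by simp
    then show False using card_ge_3 by simp
  qed
  then show "i \<noteq> s i" by metis
qed

lemma ss_neq [simp]: "s (s i) \<noteq> i" "i \<noteq> s (s i)"
proof -
  show "s (s i) \<noteq> i"
  proof
    assume "s (s i) = i"
    then have "{i, s i} = UNIV" by (intro closed_imp_UNIV) auto
    then have "CARD('n) = card {i, s i}" by simp
    also have "\<dots> \<le> 2" by (simp add: card_insert_if)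
    finally show False using card_ge_3 by simp
  qed
  then show "i \<noteq> s (s i)" by metis
qed

lemma p_neq [simp]: "p i \<noteq> i" "i \<noteq> p i" "p i \<noteq> s i" "s i \<noteq> p i"
  by (metis s_neq(1) ss_neq(1) s_p)+

lemma combination_nth:
  "(\<Sum>i\<in>UNIV. c i *\<^sub>R v i) $ j = flow c j - flow c (p j)"
proof -
  have "(\<Sum>i\<in>UNIV. c i *\<^sub>R v i) $ j = (\<Sum>i\<in>UNIV. (if i = j then c i else 0)
     - (if i = p j then c i else 0)
     + ((if i = j then if j \<in> S then c j else 0 else 0) - (if i = s j then if s j \<in> S then c (s j) else 0 else 0)))"
    unfolding sum_component
  proof (rule sum.cong)
    fix i
    have "(j = s i) = (i = p j)" "(j = p i) = (i = s j)" "(j = i) = (i = j)" by auto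
    then show "(c i *\<^sub>R v i) $ j = (if i = j then c i else 0) - (if i = p j then c i else 0)
       + ((if i = j then if j \<in> S then c j else 0 else 0)
          - (if i = s j then if s j \<in> S then c (s j) else 0 else 0))"
      by (cases "i = j"; cases "i = p j"; cases "i = s j")
        (auto simp: v_def axis_def split: if_splits)
  qed simp
  also have "\<dots> = flow c j - flow c (p j)"
    by (simp add: flow_def sum.distrib sum_subtractf)
  finally show ?thesis .
qed

lemma flow_const:
  assumes "(\<Sum>i\<in>UNIV. c i *\<^sub>R v i) = 0"
  shows "flow c i = flow c j"
  by (rule closed_imp_all[of "\<lambda>i. flow c i = flow c j" j])
    (use combination_nth[of c] assms in \<open>auto simp: vec_eq_iff\<close>, metis p_s)

section \<open>The rows span a simplex around the origin\<close>

text \<open>At a negative minimum, nonnegative flow forces the successor into \<open>S\<close> with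
  a value no larger. So the minimum spreads round the cycle and \<open>c\<close> is a negative
  constant, against sum 0. Hence \<open>c\<close> is nonnegative, and then zero.\<close>

lemma zero_of_sum_zero_flow_nonneg:
  assumes flow: "\<And>i. flow c i = k" and "0 \<le> k" and sum: "sum c UNIV = 0"
  shows "c = (\<lambda>_. 0)"
proof -
  obtain j where j: "\<And>i. c j \<le> c i"
    using ex_min_if_finite[of "range c"] by (auto simp: not_less)
  have "0 \<le> c j"
  proof (rule ccontr)
    assume neg: "\<not> 0 \<le> c j"
    have "c i = c j" for i
    proof (rule closed_imp_all[of "\<lambda>i. c i = c j" j])
      fix i assume "c i = c j"
      then show "c (s i) = c j"
        using flow[of i] \<open>0 \<le> k\<close> j[of "s i"] neg by (auto simp: flow_def split: if_splits)
    qed simp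
    then have "c = (\<lambda>_. c j)" by blast
    then have "sum c UNIV = (\<Sum>i\<in>(UNIV :: 'n set). c j)" by (rule arg_cong)
    then have "sum c UNIV = real CARD('n) * c j" by simp
    then show False using sum neg card_ge_3 by simp
  qed
  then have "0 \<le> c i" for i using j order_trans by blast
  then show ?thesis using sum by (auto simp: sum_nonneg_eq_0_iff fun_eq_iff)
qed

text \<open>The flow is constant; negating \<open>c\<close> if necessary makes it
  nonnegative.\<close>

lemma independent:
  assumes sum: "sum c UNIV = 0" and "(\<Sum>i\<in>UNIV. c i *\<^sub>R v i) = 0"
  shows "c = (\<lambda>_. 0)"
proof -
  obtain k where k: "\<And>i. flow c i = k" using flow_const[OF assms(2)] by metis
  show ?thesis
  proof (cases "0 \<le> k")
    case True
    then show ?thesis using zero_of_sum_zero_flow_nonneg[OF k] sum by blast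
  next
    case False
    have "flow (\<lambda>i. - c i) i = - k" for i using k[of i] by (auto simp: flow_def split: if_splits)
    then have "(\<lambda>i. - c i) = (\<lambda>_. 0)"
      by (rule zero_of_sum_zero_flow_nonneg) (use False sum in \<open>auto simp: sum_negf\<close>)
    then show ?thesis by (auto simp: fun_eq_iff)
  qed
qed

lemma inj_v: "inj v" and affine_independent_v: "\<not> affine_dependent (range v)"
  using affine_independent_range[of v] independent by blast+

text \<open>This puts the origin in the relative interior. Positive weights of constant flow
  suffice, as coordinates of the combination are differences of neighbouring flows; scaling then
  makes the sum 1.\<close>

lemma positive_relation:
  obtains c where "\<And>i. 0 < c i" "sum c UNIV = 1" "(\<Sum>i\<in>UNIV. c i *\<^sub>R v i) = 0"
proof -
  have "\<exists>m k. (\<forall>i. 0 < m i) \<and> (\<forall>i. flow m i = k)"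
  proof (cases "S = UNIV")
    case True
    then have "flow (\<lambda>_. 1) i = 0" for i unfolding flow_def using True by simp
    then show ?thesis by (intro exI[of _ "\<lambda>_. 1"] exI[of _ 0]) auto
  next
    case False
    then obtain a where a: "a \<notin> S" by auto
    \<comment> \<open>\<open>d i\<close> is the length of the run of \<open>S\<close> starting at \<open>s i\<close>, so \<open>1 + d\<close> has constant flow \<open>1\<close>.\<close>
    define d where "d i = (LEAST k. (s ^^ Suc k) i \<notin> S)" for i
    have ex: "\<exists>k. (s ^^ Suc k) i \<notin> S" for i
    proof (rule ccontr)
      \<comment> \<open>The successors of \<open>i\<close> exhaust the cycle, so all of it would lie
        in \<open>S\<close>.\<close>
      assume *: "\<nexists>k. (s ^^ Suc k) i \<notin> S"
      have "s j \<in> S" for j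
        using closed_imp_all[of "\<lambda>j. \<exists>k. j = (s ^^ k) i" i j] *
        by (metis funpow.simps(2) funpow_0 o_apply)
      then show False using a by (metis s_p)
    qed
    have step: "d i = (if s i \<in> S then Suc (d (s i)) else 0)" for i
    proof (cases "s i \<in> S")
      case True
      obtain k where k: "(s ^^ Suc k) i \<notin> S" using ex by blast
      have "d i = Suc (LEAST m. (s ^^ Suc (Suc m)) i \<notin> S)"
        unfolding d_def by (rule Least_Suc[of "\<lambda>k. (s ^^ Suc k) i \<notin> S", OF k]) (use True in simp)
      then show ?thesis using True by (simp add: d_def funpow_swap1)
    qed (auto simp: d_def intro!: Least_equality)
    have "flow (\<lambda>i. 1 + real (d i)) i = 1" for i
      using step[of i] by (simp add: flow_def)
    then show ?thesis by (intro exI[of _ "\<lambda>i. 1 + real (d i)"] exI[of _ 1]) auto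
  qed
  then obtain m k where m: "\<And>i. 0 < m i" and k: "\<And>i. flow m i = k" by blast
  define M where "M = sum m UNIV"
  have M: "0 < M" unfolding M_def by (rule sum_pos) (auto simp: m)
  show thesis
  proof (rule that[of "\<lambda>i. m i / M"])
    show "0 < m i / M" for i using m M by simp
    show "(\<Sum>i\<in>UNIV. m i / M) = 1" using M by (simp add: M_def flip: sum_divide_distrib)
    have "flow (\<lambda>i. m i / M) i = k / M" for i
      using k[of i] by (auto simp: flow_def diff_divide_distrib)
    then show "(\<Sum>i\<in>UNIV. (m i / M) *\<^sub>R v i) = 0"
      by (simp add: vec_eq_iff combination_nth del: sum_component)
  qed
qed

text \<open>The simplex and interior conditions always hold here, and affine independence makes the
  extreme points exactly the rows.\<close>

lemma terminal_fano_iff: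
  "terminal_fano (convex hull (range v)) \<longleftrightarrow>
    (\<forall>x \<in> convex hull (range v). (\<forall>i. x $ i \<in> \<int>) \<longrightarrow> x = 0 \<or> x \<in> range v)"
proof -
  have "(int CARD('n) - 1) simplex (convex hull (range v))"
    by (rule simplex_convex_hull) (simp add: affine_independent_v card_image[OF inj_v])
  moreover have "0 \<in> rel_interior (convex hull (range v))"
    using positive_relation rel_interior_convex_hull_range[OF inj_v affine_independent_v] by metis
  ultimately show ?thesis
    by (simp add: terminal_fano_def extreme_point_of_convex_hull_affine_independent
        affine_independent_v)
qed

section \<open>Lattice points of the simplex\<close>

text \<open>The six digraphs in rotation-invariant form; on four vertices \<open>t\<close> and
  \<open>s (s t)\<close> are opposite.\<close>

definition exceptional :: bool where
  "exceptional \<longleftrightarrow> CARD('n) = 3 \<and> S \<noteq> {} \<or> CARD('n) = 4 \<and> (\<exists>t\<in>S. s (s t) \<in> S)"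

lemma sum_subset_le_1:
  fixes A :: "'n set"
  assumes "\<And>i. 0 \<le> c i" and "sum c UNIV = (1::real)"
  shows "sum c A \<le> 1"
  using sum_mono2[OF finite subset_UNIV, of A c] assms by simp

lemma lattice_point_exceptional:
  assumes c0: "\<And>i. 0 \<le> c i" and c1: "sum c UNIV = 1"
    and x: "x = (\<Sum>i\<in>UNIV. c i *\<^sub>R v i)"
    and int: "\<And>i. x $ i \<in> \<int>" and nz: "x \<noteq> 0" and nv: "x \<notin> range v"
  shows exceptional
proof -
  note le1 = sum_subset_le_1[OF c0 c1]
  have le2: "c i + c j \<le> 1" if "i \<noteq> j" for i j using le1[of "{i, j}"] that by simp
  have le3: "c i + c j + c l \<le> 1" if "i \<noteq> j" "i \<noteq> l" "j \<noteq> l" for i j l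
    using le1[of "{i, j, l}"] that by simp
  have lt1: "c i < 1" for i
  proof (rule ccontr)
    assume "\<not> c i < 1"
    then have ci: "c i = 1" using le1[of "{i}"] by simp
    have "c j = 0" if "j \<noteq> i" for j using le2[OF that] c0[of j] ci by simp
    then have "c = (\<lambda>j. if j = i then 1 else 0)" using ci by auto
    then have "x = v i"
      unfolding x by (simp add: if_distrib[of "\<lambda>r. r *\<^sub>R _"] cong: if_cong)
    then show False using nv by simp
  qed
  let ?f = "flow c"
  have bounds: "- 1 < ?f i" "?f i < 1" for i
    using lt1[of i] lt1[of "s i"] c0[of i] c0[of "s i"] by (auto simp: flow_def)
  obtain a :: 'n where True by simp
  define \<theta> where "\<theta> = frac (?f a)"
  have frac: "frac (?f i) = \<theta>" for i
  proof (rule closed_imp_all[of "\<lambda>i. frac (?f i) = \<theta>" a])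
    fix i assume i: "frac (?f i) = \<theta>"
    obtain k where "?f (s i) - ?f i = of_int k"
      using int[of "s i"] unfolding x combination_nth by (auto elim: Ints_cases)
    then have "?f (s i) = ?f i + of_int k" by simp
    then show "frac (?f (s i)) = \<theta>" using i by (simp add: frac_def)
  qed (simp add: \<theta>_def)
  have nconst: "\<not> (\<forall>i. ?f i = k)" for k
    using nz unfolding x vec_eq_iff combination_nth by force
  have cases: "?f i = \<theta> \<or> ?f i = \<theta> - 1" for i
  proof -
    have "\<lfloor>?f i\<rfloor> = 0 \<or> \<lfloor>?f i\<rfloor> = - 1" using bounds[of i] by linarith
    then show ?thesis using frac[of i] by (auto simp: frac_def)
  qed
  have "0 \<le> \<theta>" "\<theta> < 1" by (simp_all add: \<theta>_def frac_lt_1)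
  \<comment> \<open>For \<theta> = 0 the strict bounds exclude the value -1, so the flow would
    vanish.\<close>
  moreover have "\<theta> \<noteq> 0"
  proof
    assume "\<theta> = 0"
    then have "?f i = 0" for i using cases[of i] bounds(1)[of i] by auto
    then show False using nconst[of 0] by simp
  qed
  ultimately have \<theta>: "0 < \<theta>" "\<theta> < 1" by auto
  define A where "A = {i. ?f i = \<theta>}"
  have in_A: "\<theta> \<le> c i" if "i \<in> A" for i
    using that c0[of "s i"] by (auto simp: A_def flow_def split: if_splits)
  have not_A: "s i \<in> S" "1 - \<theta> \<le> c (s i)" if "i \<notin> A" for i
  proof -
    have "?f i = \<theta> - 1" using that cases[of i] by (simp add: A_def)
    then show "s i \<in> S" "1 - \<theta> \<le> c (s i)"
      using c0[of i] \<theta> by (auto simp: flow_def split: if_splits)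
  qed
  \<comment> \<open>Without a jump up from \<theta> - 1 to \<theta>, the nonempty complement of
    \<open>A\<close> would be closed under \<open>s\<close> and the flow constant.\<close>
  have "\<exists>t. t \<in> A \<and> p t \<notin> A"
  proof (rule ccontr)
    assume *: "\<not> ?thesis"
    obtain b where "b \<notin> A" using nconst[of \<theta>] by (auto simp: A_def)
    then have "i \<notin> A" for i
      by (rule closed_imp_all[of "\<lambda>i. i \<notin> A"]) (use * in \<open>metis p_s\<close>)
    then show False using nconst[of "\<theta> - 1"] cases by (auto simp: A_def)
  qed
  then obtain t where t: "t \<in> A" "p t \<notin> A" by blast
  have ct: "\<theta> \<le> c u" "1 - \<theta> \<le> c u" "u \<in> S" if "u \<in> A" "p u \<notin> A" for u
    using in_A[OF that(1)] not_A[OF that(2)] by simp_all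
  \<comment> \<open>Two places where the flow jumps up already use the whole weight.\<close>
  show ?thesis
  proof (cases "\<exists>u. u \<in> A \<and> p u \<notin> A \<and> u \<noteq> t")
    case True
    then obtain u where u: "u \<in> A" "p u \<notin> A" "u \<noteq> t" by blast
    \<comment> \<open>Both \<open>c t\<close> and \<open>c u\<close> are at least the larger of
      \<theta> and 1 - \<theta>.\<close>
    have half: "\<theta> = 1/2" using le2[OF u(3)] ct[OF t] ct[OF u(1,2)] by linarith
    have other: "w \<notin> A" "p w \<in> A" if "w \<noteq> t" "w \<noteq> u" for w
    proof -
      have "c w \<le> 0" using le3[of w t u] that u(3) ct[OF t] ct[OF u(1,2)] half by auto
      then show "w \<notin> A" "p w \<in> A" using in_A[of w] not_A[of "p w"] half by auto
    qed
    have st: "s y \<notin> A" if "y \<in> {t, u}" for y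
      by (metis other(1) p_s s_neq insert_iff singletonD that t u(1,2))
    \<comment> \<open>As \<open>s t\<close> is outside \<open>A\<close>, \<open>other\<close> leaves
      only \<open>t\<close> and \<open>u\<close> for \<open>s (s t)\<close>; likewise for
      \<open>s (s u)\<close>.\<close>
    have sst: "s (s t) = u" and ssu: "s (s u) = t"
      using other(2)[of "s (s t)"] other(2)[of "s (s u)"] st by auto
    have "{t, s t, u, s u} = UNIV" by (rule closed_imp_UNIV) (auto simp: sst ssu)
    then have "CARD('n) = card {t, s t, u, s u}" by simp
    also have "\<dots> = 4" using st t(1) u by (auto simp: card_insert_if)
    finally show ?thesis using ct(3)[OF t] ct(3)[OF u(1,2)] sst by (auto simp: exceptional_def)
  next
    case False
    then have uniq: "u = t" if "u \<in> A" "p u \<notin> A" for u using that by blast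
    have "CARD('n) \<le> 3"
    proof (rule ccontr)
      assume "\<not> CARD('n) \<le> 3"
      then have ex: "\<exists>w. w \<notin> B" if "card B \<le> 3" for B :: "'n set"
        using that by (metis UNIV_eq_I)
      obtain w where w: "w \<notin> {t, p t}" using ex[of "{t, p t}"] by (auto simp: card_insert_if)
      have card_3: "card {t, p t, w} \<le> 3" by (simp add: card_insert_if)
      obtain w' where w': "w' \<notin> {t, p t, w}" using ex[OF card_3] by blast
      have w: "w \<noteq> w'" "w \<notin> {t, p t}" "w' \<notin> {t, p t}" using w w' by auto
      \<comment> \<open>Every vertex other than \<open>t\<close> and its predecessor forces a further positive weight.\<close>
      let ?d = "\<lambda>w. if w \<in> A then w else s w"
      \<comment> \<open>If \<open>w\<close> is outside \<open>A\<close> and \<open>s w\<close>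
        inside, \<open>uniq\<close> gives \<open>s w = t\<close>, that is
        \<open>w = p t\<close>.\<close>
      have d: "?d w \<noteq> t \<and> (?d w \<in> A \<longleftrightarrow> w \<in> A)
          \<and> (if w \<in> A then \<theta> else 1 - \<theta>) \<le> c (?d w)" if "w \<notin> {t, p t}" for w
        using that uniq[of "s w"] in_A not_A by auto
      \<comment> \<open>\<open>?d\<close> preserves \<open>A\<close> and its complement and is
        injective on each.\<close>
      have "?d w \<noteq> ?d w'"
        using d[OF w(2)] d[OF w(3)] w(1) by (metis s_eq_iff)
      then have "c (?d w) + c (?d w') + c t \<le> 1" using d w by (intro le3) blast+
      \<comment> \<open>Since \<open>c t\<close> is at least \<theta> and at least 1 - \<theta>, the
        three weights exceed 1 in every case.\<close>
      then show False
        using d[OF w(2)] d[OF w(3)] ct[OF t] \<theta> by (auto split: if_splits)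
    qed
    then show ?thesis using card_ge_3 ct(3)[OF t] by (auto simp: exceptional_def)
  qed
qed

section \<open>Further lattice points in the exceptional cases\<close>

text \<open>A point strictly between two vertices is never extreme, so it cannot be a nonzero
  lattice point.\<close>

lemma not_terminal_fano:
  assumes "i \<noteq> k" and "0 < u" "u < 1" and "x = (1 - u) *\<^sub>R v i + u *\<^sub>R v k"
    and "\<And>j. x $ j \<in> \<int>" and "x $ l \<noteq> 0"
  shows "\<not> terminal_fano (convex hull (range v))"
proof
  assume tf: "terminal_fano (convex hull (range v))"
  have hull: "v i \<in> convex hull (range v)" "v k \<in> convex hull (range v)"
    by (auto intro: hull_inc)
  have "x \<in> open_segment (v i) (v k)"
    using assms(1-4) inj_v by (auto simp: in_segment inj_eq)
  moreover from this have "x \<in> convex hull (range v)"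
    using hull by (meson convex_convex_hull convex_contains_open_segment subsetD)
  ultimately show False
    using tf hull assms(5,6) by (auto simp: terminal_fano_def extreme_point_of_def zero_index)
qed

lemma v_nth: "v i $ j = (if j = i then 1 else 0) - (if j = s i then 1 else 0)
    + (if i \<in> S then (if j = i then 1 else 0) - (if j = p i then 1 else 0) else 0)"
  by (simp add: v_def axis_def)

lemma not_terminal_fano_exceptional:
  assumes exceptional
  shows "\<not> terminal_fano (convex hull (range v))"
  using assms unfolding exceptional_def
proof (elim disjE conjE bexE)
  assume card: "CARD('n) = 3" and "S \<noteq> {}"
  then obtain t where t: "t \<in> S" by auto
  have "{t, s t, s (s t)} = UNIV"
    by (rule card_subset_eq) (auto simp: card)
  then have all: "j = t \<or> j = s t \<or> j = s (s t)" for j by (metis UNIV_I insert_iff singletonD)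
  from all[of "s (s (s t))"] have "s (s (s t)) = t" by auto
  then have p: "p t = s (s t)" by (metis p_s)
  show ?thesis
  proof (cases "s t \<in> S")
    case True
    \<comment> \<open>In the coordinates \<open>t\<close>, \<open>s t\<close>,
      \<open>s (s t)\<close> the rows are (2,-1,-1) and (-1,2,-1); weights 2/3 and 1/3 give
      (1,0,-1).\<close>
    show ?thesis
    proof (rule not_terminal_fano[of t "s t" "1/3" _ t])
      let ?x = "(1 - 1/3) *\<^sub>R v t + (1/3) *\<^sub>R v (s t)"
      show "?x $ j \<in> \<int>" for j
        using all[of j] True t by (auto simp: v_nth p)
      show "?x $ t \<noteq> 0" using True t by (simp add: v_nth p)
    qed auto
  next
    case False
    \<comment> \<open>Now the second row is (0,1,-1), and the midpoint is (1,0,-1).\<close>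
    show ?thesis
    proof (rule not_terminal_fano[of t "s t" "1/2" _ t])
      let ?x = "(1 - 1/2) *\<^sub>R v t + (1/2) *\<^sub>R v (s t)"
      show "?x $ j \<in> \<int>" for j
        using all[of j] False t by (auto simp: v_nth p)
      show "?x $ t \<noteq> 0" using False t by (simp add: v_nth p)
    qed auto
  qed
next
  fix t assume card: "CARD('n) = 4" and t: "t \<in> S" "s (s t) \<in> S"
  have ne: "s (s (s t)) \<noteq> t"
  proof
    assume eq: "s (s (s t)) = t"
    have "{t, s t, s (s t)} = UNIV" by (rule closed_imp_UNIV) (auto simp: eq)
    then have "CARD('n) = card {t, s t, s (s t)}" by simp
    then show False using card by (simp add: card_insert_if)
  qed
  have "{t, s t, s (s t), s (s (s t))} = UNIV"
    by (rule card_subset_eq) (use ne ne[symmetric] in \<open>auto simp: card card_insert_if\<close>)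
  then have all: "j = t \<or> j = s t \<or> j = s (s t) \<or> j = s (s (s t))" for j
    by (metis UNIV_I insert_iff singletonD)
  from all[of "s (s (s (s t)))"] ne have "s (s (s (s t))) = t" by auto
  then have p: "p t = s (s (s t))" by (metis p_s)
  \<comment> \<open>The midpoint of the rows (2,-1,0,-1) and (0,-1,2,-1) is (1,-1,1,-1).\<close>
  show ?thesis
  proof (rule not_terminal_fano[of t "s (s t)" "1/2" _ t])
    let ?x = "(1 - 1/2) *\<^sub>R v t + (1/2) *\<^sub>R v (s (s t))"
    show "?x $ j \<in> \<int>" for j
      using all[of j] t ne by (auto simp: v_nth p)
    show "?x $ t \<noteq> 0" using t ne ne[symmetric] by (simp add: v_nth p)
  qed auto
qed

lemma terminal_fano_iff_not_exceptional:
  "terminal_fano (convex hull (range v)) \<longleftrightarrow> \<not> exceptional"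
proof
  assume "\<not> exceptional"
  show "terminal_fano (convex hull (range v))"
    unfolding terminal_fano_iff
  proof (intro ballI impI)
    fix x assume x: "x \<in> convex hull (range v)" and int: "\<forall>i. x $ i \<in> \<int>"
    obtain c
      where "\<And>i. 0 \<le> c i" "sum c UNIV = 1" "x = (\<Sum>i\<in>UNIV. c i *\<^sub>R v i)"
      using convex_hull_range_finite[OF inj_v x] by blast
    from lattice_point_exceptional[OF this] int \<open>\<not> exceptional\<close>
    show "x = 0 \<or> x \<in> range v" by auto
  qed
qed (use not_terminal_fano_exceptional in blast)

end

section \<open>Rotations of cycle digraphs\<close>

definition cyc_succ :: "nat \<Rightarrow> nat \<Rightarrow> nat" where
  "cyc_succ n i = (if i = n then 1 else i + 1)"

definition cyc_pred :: "nat \<Rightarrow> nat \<Rightarrow> nat" where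
  "cyc_pred n i = (if i = 1 then n else i - 1)"

lemma cyc_simps:
  assumes "i \<in> {1..n}"
  shows "cyc_succ n i \<in> {1..n}" "cyc_pred n i \<in> {1..n}"
    "cyc_succ n (cyc_pred n i) = i" "cyc_pred n (cyc_succ n i) = i"
  using assms by (auto simp: cyc_succ_def cyc_pred_def)

lemma parcs_cycle:
  assumes "n \<ge> 1"
  shows "parcs (cycle_pair_digraph n S) =
    (\<lambda>i. (i, cyc_succ n i)) ` {1..n} \<union> (\<lambda>i. (i, cyc_pred n i)) ` S"
proof -
  have "{1..n} = insert n {1..<n}" using assms by auto
  moreover have "(\<lambda>i. (i, cyc_succ n i)) ` {1..<n} = {(i, i + 1) | i. i \<in> {1..<n}}"
    unfolding Setcompr_eq_image by (intro image_cong) (auto simp: cyc_succ_def)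
  ultimately have "(\<lambda>i. (i, cyc_succ n i)) ` {1..n} = {(i, i + 1) | i. i \<in> {1..<n}} \<union> {(n, 1)}"
    by (simp add: cyc_succ_def)
  then show ?thesis
    by (simp only: cycle_pair_digraph_def pair_pre_digraph.simps cyc_pred_def Setcompr_eq_image)
qed

lemma pverts_cycle: "pverts (cycle_pair_digraph n S) = {1..n}"
  by (simp add: cycle_pair_digraph_def)

lemma wf_digraph_cycle:
  assumes "n \<ge> 1" "S \<subseteq> {1..n}"
  shows "wf_digraph (cycle_graph n S)"
proof
  fix e assume "e \<in> arcs (cycle_graph n S)"
  then have "e \<in> (\<lambda>i. (i, cyc_succ n i)) ` {1..n} \<union> (\<lambda>i. (i, cyc_pred n i)) ` S"
    using parcs_cycle[OF assms(1)] by simp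
  then show "tail (cycle_graph n S) e \<in> verts (cycle_graph n S)"
    "head (cycle_graph n S) e \<in> verts (cycle_graph n S)"
    using assms(2) cyc_simps(1,2)[of _ n] by (auto simp: pverts_cycle simp del: atLeastAtMost_iff One_nat_def)
qed

lemma bij_betw_cyc_succ: "bij_betw (cyc_succ n) {1..n} {1..n}"
  by (rule bij_betw_byWitness[of _ "cyc_pred n"]) (use cyc_simps[of _ n] in blast)+

text \<open>Rotation commutes with successor and predecessor, so it carries forward arcs to forward
  arcs and the backward arcs at \<open>S\<close> to those at the rotated set.\<close>

lemma digraph_iso_cycle_succ:
  assumes "n \<ge> 1" "S \<subseteq> {1..n}"
  shows "digraph_iso (cycle_graph n S) (cycle_graph n (cyc_succ n ` S))"
proof -
  let ?g = "cyc_succ n"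
  let ?h = "\<lparr>iso_verts = ?g, iso_arcs = map_prod ?g ?g, iso_head = snd, iso_tail = fst\<rparr>"
  have img: "?g ` {1..n} = {1..n}" and inj: "inj_on ?g {1..n}"
    using bij_betw_cyc_succ by (auto simp: bij_betw_def)
  have sub: "parcs (cycle_pair_digraph n S) \<subseteq> {1..n} \<times> {1..n}"
    using assms(2) cyc_simps[of _ n] unfolding parcs_cycle[OF assms(1)] by (auto simp: subset_iff)
  have "inj_on (map_prod ?g ?g) (parcs (cycle_pair_digraph n S))"
    by (rule inj_on_subset[OF map_prod_inj_on[OF inj inj] sub])
  then have "pre_digraph.digraph_isomorphism (cycle_graph n S) ?h"
    using inj wf_digraph_cycle[OF assms]
    by (auto simp: pre_digraph.digraph_isomorphism_def cycle_pair_digraph_def)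
  moreover have arcs: "map_prod ?g ?g ` parcs (cycle_pair_digraph n S) =
      parcs (cycle_pair_digraph n (?g ` S))"
  proof -
    have "map_prod ?g ?g ` parcs (cycle_pair_digraph n S) =
        (\<lambda>i. (?g i, ?g (?g i))) ` {1..n} \<union> (\<lambda>i. (?g i, ?g (cyc_pred n i))) ` S"
      unfolding parcs_cycle[OF assms(1)] image_Un image_image by simp
    also have "(\<lambda>i. (?g i, ?g (?g i))) ` {1..n} = (\<lambda>i. (i, ?g i)) ` {1..n}"
    proof -
      have "(\<lambda>i. (?g i, ?g (?g i))) ` {1..n} = (\<lambda>i. (i, ?g i)) ` ?g ` {1..n}"
        by (simp only: image_image)
      then show ?thesis by (simp only: img)
    qed
    also have "(\<lambda>i. (?g i, ?g (cyc_pred n i))) ` S = (\<lambda>i. (i, cyc_pred n i)) ` ?g ` S"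
      unfolding image_image using assms(2) cyc_simps(3,4) by (intro image_cong) auto
    finally show ?thesis unfolding parcs_cycle[OF assms(1)] .
  qed
  ultimately show ?thesis
    unfolding digraph_iso_def
    by (intro exI[of _ ?h]) (simp add: app_iso_def with_proj_def pverts_cycle img del: One_nat_def)
qed

lemma digraph_iso_cycle_rotate:
  assumes "digraph_iso (cycle_graph n S) D" "n \<ge> 1" "S \<subseteq> {1..n}"
  shows "digraph_iso (cycle_graph n (cyc_succ n ` S)) D"
  by (rule digraph_iso_trans[OF digraph_iso_swap[OF wf_digraph_cycle digraph_iso_cycle_succ] assms(1)])
    (use assms in auto)

section \<open>From cycle digraphs to the abstract cycle\<close>

text \<open>The isomorphism carries the cyclic order of \<open>{1..n}\<close> to the vertex type,
  where the Laplacian rows become the vectors \<open>v\<close> of the locale.\<close>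

lemma terminal_fano_cycle_iff:
  fixes D :: "('n::finite, 'e) pre_digraph"
  assumes "verts D = UNIV" and n: "n \<ge> 3" and S: "S \<subseteq> {1..n}"
    and iso: "digraph_iso (cycle_graph n S) D"
  shows "terminal_fano (laplacian_polytope D) \<longleftrightarrow>
    \<not> (n = 3 \<and> S \<noteq> {} \<or> n = 4 \<and> ({1, 3} \<subseteq> S \<or> {2, 4} \<subseteq> S))"
proof -
  let ?G = "cycle_graph n S"
  obtain h where h: "pre_digraph.digraph_isomorphism ?G h" and D: "D = app_iso h ?G"
    using iso by (auto simp: digraph_iso_def)
  define f where "f = iso_verts h"
  have "bij_betw f {1..n} UNIV"
    using pre_digraph.digraph_isomorphism_inj_on_verts[OF h] assms(1)
    by (auto simp: bij_betw_def f_def D pverts_cycle)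
  then have inj: "inj_on f {1..n}" and surj: "f ` {1..n} = UNIV" and card: "CARD('n) = n"
    using bij_betw_same_card[of f "{1..n}" UNIV] by (simp_all add: bij_betw_def)
  have f_eq: "f a = f b \<longleftrightarrow> a = b" if "a \<in> {1..n}" "b \<in> {1..n}" for a b
    using inj that by (auto dest: inj_onD)
  define g where "g = inv_into {1..n} f"
  have g: "g i \<in> {1..n}" "f (g i) = i" for i
    using inv_into_into[of i f "{1..n}"] f_inv_into_f[of i f "{1..n}"] surj by (auto simp: g_def)
  have g_f: "g (f a) = a" if "a \<in> {1..n}" for a
    unfolding g_def using inj that by (rule inv_into_f_f)
  define s where "s i = f (cyc_succ n (g i))" for i
  define p where "p i = f (cyc_pred n (g i))" for i
  have s_f: "s (f a) = f (cyc_succ n a)" and p_f: "p (f a) = f (cyc_pred n a)"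
    if "a \<in> {1..n}" for a using that by (simp_all add: s_def p_def g_f)
  interpret cyclic_rows s p "f ` S"
  proof
    show "s (p i) = i" "p (s i) = i" for i
      using cyc_simps[OF g(1)[of i]] by (simp_all add: s_def p_def g_f g(2))
    show "3 \<le> CARD('n)" using n card by simp
    fix A :: "'n set" assume "A \<noteq> {}" and closed: "\<And>i. i \<in> A \<Longrightarrow> s i \<in> A"
    then obtain i where "i \<in> A" by blast
    \<comment> \<open>Closure climbs from any vertex to \<open>n\<close>, wraps round to 1, and
      climbs again through everything.\<close>
    have up: "f m \<in> A" if "f k \<in> A" "1 \<le> k" "k \<le> m" "m \<le> n" for k m
      using that(3,1,2,4)
    proof (induction m rule: dec_induct)
      case (step m)
      then show ?case using closed[of "f m"] s_f[of m] by (simp add: cyc_succ_def)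
    qed
    have "f n \<in> A" using up[of "g i" n] g[of i] \<open>i \<in> A\<close> by simp
    then have "f 1 \<in> A" using closed[of "f n"] s_f[of n] n by (simp add: cyc_succ_def)
    then have "f ` {1..n} \<subseteq> A" using up[of 1] by auto
    then show "A = UNIV" using surj by blast
  qed
  have adj: "adj_mat D $ i $ j = (if j = s i then 1 else 0) + (if i \<in> f ` S \<and> j = p i then 1 else 0)"
    for i j
  proof -
    obtain a b where ab: "a \<in> {1..n}" "b \<in> {1..n}" "i = f a" "j = f b"
      using g[of i] g[of j] by metis
    let ?P = "parcs (cycle_pair_digraph n S)"
    have P: "?P \<subseteq> {1..n} \<times> {1..n}"
      using S cyc_simps[of _ n] parcs_cycle[of n S] n by (auto simp: subset_iff)
    have "{e \<in> arcs D. tail D e = i \<and> head D e = j} = iso_arcs h ` {e \<in> ?P. f (fst e) = i \<and> f (snd e) = j}"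
      using h unfolding pre_digraph.digraph_isomorphism_def D f_def by auto
    also have "{e \<in> ?P. f (fst e) = i \<and> f (snd e) = j} = {e \<in> ?P. e = (a, b)}"
      using P ab f_eq by force
    also have "card (iso_arcs h ` \<dots>) = card {e \<in> ?P. e = (a, b)}"
      using pre_digraph.digraph_isomorphism_inj_on_arcs[OF h]
      by (intro card_image) (auto intro: inj_on_subset)
    also have "\<dots> = (if (a, b) \<in> ?P then 1 else 0)"
      by (auto simp: Collect_conv_if)
    also have "(a, b) \<in> ?P \<longleftrightarrow> j = s i \<or> i \<in> f ` S \<and> j = p i"
    proof -
      have "i \<in> f ` S \<longleftrightarrow> a \<in> S" unfolding ab using f_eq[OF ab(1)] S by blast
      moreover have "j = s i \<longleftrightarrow> b = cyc_succ n a" "j = p i \<longleftrightarrow> b = cyc_pred n a"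
        unfolding ab s_f[OF ab(1)] p_f[OF ab(1)] using f_eq ab cyc_simps[OF ab(1)] by blast+
      ultimately show ?thesis using parcs_cycle[of n S] n ab(1) by auto
    qed
    \<comment> \<open>\<open>p i\<close> and \<open>s i\<close> differ, so at most one of the two
      indicators is 1.\<close>
    finally show ?thesis using p_neq by (auto simp: adj_mat_def)
  qed
  have "row i (laplacian D) = v i" for i
  proof -
    have "(\<Sum>k\<in>UNIV. adj_mat D $ i $ k) = 1 + (if i \<in> f ` S then 1 else 0)"
      by (simp add: adj sum.distrib)
    then show ?thesis
      using p_neq s_neq by (auto simp: vec_eq_iff row_def laplacian_def outdeg_mat_def adj v_nth)
  qed
  then have "laplacian_polytope D = convex hull (range v)"
    unfolding laplacian_polytope_def rows_def by (simp add: full_SetCompr_eq)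
  moreover have "exceptional \<longleftrightarrow> n = 3 \<and> S \<noteq> {} \<or> n = 4 \<and> ({1, 3} \<subseteq> S \<or> {2, 4} \<subseteq> S)"
  proof -
    have "(\<exists>t\<in>f ` S. s (s t) \<in> f ` S) \<longleftrightarrow> {1, 3} \<subseteq> S \<or> {2, 4} \<subseteq> S" if "n = 4"
    proof -
      have S4: "a \<in> {1, 2, 3, 4}" if "a \<in> S" for a
        using that S \<open>n = 4\<close> by force
      have "s (s (f a)) \<in> f ` S \<longleftrightarrow> cyc_succ n (cyc_succ n a) \<in> S" if "a \<in> S" for a
      proof -
        have a: "a \<in> {1..n}" using that S by blast
        have "s (s (f a)) = f (cyc_succ n (cyc_succ n a))"
          by (simp only: s_f[OF a] s_f[OF cyc_simps(1)[OF a]])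
        then show ?thesis
          using inj_on_image_mem_iff[OF inj _ S] cyc_simps(1)[OF cyc_simps(1)[OF a]] by simp
      qed
      then have "(\<exists>t\<in>f ` S. s (s t) \<in> f ` S) \<longleftrightarrow> (\<exists>a\<in>S. cyc_succ n (cyc_succ n a) \<in> S)"
        by auto
      also have "\<dots> \<longleftrightarrow> (\<exists>a\<in>{1,2,3,4}. a \<in> S \<and> cyc_succ 4 (cyc_succ 4 a) \<in> S)"
        using S4 \<open>n = 4\<close> by blast
      \<comment> \<open>Applying \<open>cyc_succ 4\<close> twice swaps 1 with 3 and 2 with
        4.\<close>
      also have "\<dots> \<longleftrightarrow> {1, 3} \<subseteq> S \<or> {2, 4} \<subseteq> S"
        by (auto simp: cyc_succ_def numeral_eq_Suc)
      finally show ?thesis .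
    qed
    then show ?thesis by (auto simp: exceptional_def card)
  qed
  ultimately show ?thesis using terminal_fano_iff_not_exceptional by simp
qed

section \<open>Exceptional digraphs up to rotation\<close>

text \<open>The nonempty subsets form one rotation class per cardinality.\<close>

lemma cycle_3_classification:
  assumes D: "digraph_iso (cycle_graph 3 S) D" and S: "S \<subseteq> {1..3}" "S \<noteq> {}"
  shows "digraph_iso (cycle_graph 3 {1}) D \<or> digraph_iso (cycle_graph 3 {1, 2}) D \<or>
    digraph_iso (cycle_graph 3 {1, 2, 3}) D"
proof -
  have rot: "digraph_iso (cycle_graph 3 T') D"
    if "digraph_iso (cycle_graph 3 T) D" "T \<subseteq> {1..3}" "cyc_succ 3 ` T = T'" for T T'
    using digraph_iso_cycle_rotate[OF that(1) _ that(2)] that(3) by simp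
  have elems: "x = 1 \<or> x = 2 \<or> x = 3" if "x \<in> S" for x
    using that S(1) by force
  then have "S \<in> Pow {1, 2, 3}" by blast
  with S(2) consider "S = {1}" | "S = {2}" | "S = {3}" | "S = {1, 2}" | "S = {2, 3}" | "S = {1, 3}"
    | "S = {1, 2, 3}" by (auto simp: Pow_insert)
  then show ?thesis
  proof cases
    case 2
    have "digraph_iso (cycle_graph 3 {3}) D"
      by (rule rot[of "{2}"]) (use D 2 in \<open>auto simp: cyc_succ_def\<close>)
    then have "digraph_iso (cycle_graph 3 {1}) D"
      by (rule rot) (auto simp: cyc_succ_def)
    then show ?thesis by simp
  next
    case 3
    have "digraph_iso (cycle_graph 3 {1}) D"
      by (rule rot[of "{3}"]) (use D 3 in \<open>auto simp: cyc_succ_def\<close>)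
    then show ?thesis by simp
  next
    case 5
    have "digraph_iso (cycle_graph 3 {1, 3}) D"
      by (rule rot[of "{2, 3}"]) (use D 5 in \<open>auto simp: cyc_succ_def\<close>)
    then have "digraph_iso (cycle_graph 3 {1, 2}) D"
      by (rule rot) (auto simp: cyc_succ_def)
    then show ?thesis by simp
  next
    case 6
    have "digraph_iso (cycle_graph 3 {1, 2}) D"
      by (rule rot[of "{1, 3}"]) (use D 6 in \<open>auto simp: cyc_succ_def\<close>)
    then show ?thesis by simp
  qed (use D in simp_all)
qed

text \<open>One rotation turns sets containing 2 and 4 into sets containing 1 and 3. Of these only
  \<open>{1, 3, 4}\<close> is not listed, and two rotations take it to
  \<open>{1, 2, 3}\<close>.\<close>

lemma cycle_4_classification:
  assumes D: "digraph_iso (cycle_graph 4 S) D" and S: "S \<subseteq> {1..4}"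
    and "{1, 3} \<subseteq> S \<or> {2, 4} \<subseteq> S"
  shows "digraph_iso (cycle_graph 4 {1, 3}) D \<or> digraph_iso (cycle_graph 4 {1, 2, 3}) D \<or>
    digraph_iso (cycle_graph 4 {1, 2, 3, 4}) D"
proof -
  have rot: "digraph_iso (cycle_graph 4 T') D"
    if "digraph_iso (cycle_graph 4 T) D" "T \<subseteq> {1..4}" "cyc_succ 4 ` T = T'" for T T'
    using digraph_iso_cycle_rotate[OF that(1) _ that(2)] that(3) by simp
  have *: ?thesis if D: "digraph_iso (cycle_graph 4 T) D" and T: "T \<subseteq> {1..4}" "{1, 3} \<subseteq> T" for T
  proof -
    have elems: "x = 1 \<or> x = 2 \<or> x = 3 \<or> x = 4" if "x \<in> T" for x
      using that T(1) by force
    then have "T \<in> Pow {1, 2, 3, 4}" by blast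
    with T(2) consider "T = {1, 3}" | "T = {1, 2, 3}" | "T = {1, 3, 4}" | "T = {1, 2, 3, 4}"
      by (auto simp: Pow_insert)
    then show ?thesis
    proof cases
      case 3
      have "digraph_iso (cycle_graph 4 {1, 2, 4}) D"
        by (rule rot[of "{1, 3, 4}"]) (use D 3 in \<open>auto simp: cyc_succ_def\<close>)
      then have "digraph_iso (cycle_graph 4 {1, 2, 3}) D"
        by (rule rot) (auto simp: cyc_succ_def)
      then show ?thesis by simp
    qed (use D in simp_all)
  qed
  from assms(3) show ?thesis
  proof
    assume sub: "{2, 4} \<subseteq> S"
    show ?thesis
    proof (rule *)
      show "digraph_iso (cycle_graph 4 (cyc_succ 4 ` S)) D" using rot[OF D S] by simp
      show "cyc_succ 4 ` S \<subseteq> {1..4}" using S cyc_simps(1)[of _ 4] by blast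
      show "{1, 3} \<subseteq> cyc_succ 4 ` S" using sub by (force simp: cyc_succ_def)
    qed
  qed (use * D S in blast)
qed

theorem theorem17:
  fixes D :: "('n::finite, 'e) pre_digraph"
  assumes "verts D = UNIV" and "cycle_digraph D"
  shows "terminal_fano (laplacian_polytope D) \<longleftrightarrow>
    \<not> (digraph_iso (cycle_graph 3 {1}) D \<or>
       digraph_iso (cycle_graph 3 {1, 2}) D \<or>
       digraph_iso (cycle_graph 3 {1, 2, 3}) D \<or>
       digraph_iso (cycle_graph 4 {1, 3}) D \<or>
       digraph_iso (cycle_graph 4 {1, 2, 3}) D \<or>
       digraph_iso (cycle_graph 4 {1, 2, 3, 4}) D)"
proof
  obtain n S where n: "n \<ge> 3" and S: "S \<subseteq> {1..n}" and iso: "digraph_iso (cycle_graph n S) D"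
    using assms(2) by (auto simp: cycle_digraph_def)
  note iff = terminal_fano_cycle_iff[OF assms(1)]
  show "terminal_fano (laplacian_polytope D)" if "\<not> (digraph_iso (cycle_graph 3 {1}) D \<or>
       digraph_iso (cycle_graph 3 {1, 2}) D \<or> digraph_iso (cycle_graph 3 {1, 2, 3}) D \<or>
       digraph_iso (cycle_graph 4 {1, 3}) D \<or> digraph_iso (cycle_graph 4 {1, 2, 3}) D \<or>
       digraph_iso (cycle_graph 4 {1, 2, 3, 4}) D)"
    using that iff[OF n S iso] cycle_3_classification[of S D] cycle_4_classification[of S D] S iso
    by blast
  show "\<not> (digraph_iso (cycle_graph 3 {1}) D \<or>
       digraph_iso (cycle_graph 3 {1, 2}) D \<or> digraph_iso (cycle_graph 3 {1, 2, 3}) D \<or>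
       digraph_iso (cycle_graph 4 {1, 3}) D \<or> digraph_iso (cycle_graph 4 {1, 2, 3}) D \<or>
       digraph_iso (cycle_graph 4 {1, 2, 3, 4}) D)" if "terminal_fano (laplacian_polytope D)"
    \<comment> \<open>Each of the six isomorphisms is itself a presentation of \<open>D\<close> to
      which the criterion applies.\<close>
    using that iff[of 3 "{1}"] iff[of 3 "{1, 2}"] iff[of 3 "{1, 2, 3}"]
      iff[of 4 "{1, 3}"] iff[of 4 "{1, 2, 3}"] iff[of 4 "{1, 2, 3, 4}"] by auto
qed

end
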